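(* Let $r\in(0,1)$, $\rho\in[0,1)$, $\tau^2>0$ and the threshold $p\in(0,1)$ be fixed. Under the null model, as $n\to\infty$, the false positive probability satisfies $$P(\text{false positive}\mid r,\rho,\tau^2)=O\Bigl(n^{-\frac{1-\rho}{\tau^2}}(\log n)^{-1/2}\Bigr).$$
   Context: Setting. For $n\ge 2$ and $\rho\in[0,1)$, $\boldsymbol X=(X_1,\dots,X_n)'$ is multivariate normal with mean $\boldsymbol\theta=(\theta_1,\dots,\theta_n)'$ and covariance matrix $\Sigma_0$ having all diagonal entries $1$ and all off-diagonal entries $\rho$. The models are $M_0:\theta_1=\dots=\theta_n=0$ (null model) and, for $i=1,\dots,n$, $M_i:\theta_i\ne 0,\ \theta_k=0$ for all $k\neq i$. Bayesian procedure. Prior model probabilities are $P(M_0)=r$ and $P(M_i)=(1-r)/n$ for $i\ge1$. Under $M_i$ ($i\ge 1$) the prior on $\theta_i$ is $N(0,\tau^2)$. The marginal density $m_0$ of $\boldsymbol x$ under $M_0$ is that of $N(\boldsymbol 0,\Sigma_0)$, and the marginal density $m_i$ under $M_i$ is that of $N(\boldsymbol 0,\Sigma_i)$, where $\Sigma_i$ is $\Sigma_0$ with its $(i,i)$ entry replaced by $1+\tau^2$. The posterior probabilities are $P(M_i\mid\boldsymbol x)=m_i(\boldsymbol x)P(M_i)/\sum_{j=0}^n m_j(\boldsymbol x)P(M_j)$. Bayesian detection criterion with threshold $p\in(0,1)$: accept model $M_i$ if $P(M_i\mid\boldsymbol x)>p$; if several models pass the threshold, choose the one with the largest posterior probability.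 The false positive probability (FPP) is the frequentist probability, when $\boldsymbol X\sim N(\boldsymbol 0,\Sigma_0)$ (null model), that a non-null model is accepted, i.e. that $P(M_i\mid\boldsymbol X)>p$ for some $i\in\{1,\dots,n\}$. *)

theory Defs
  imports
    "HOL-Probability.Probability"
    "HOL-Library.Landau_Symbols"
    "Jordan_Normal_Form.Gauss_Jordan_Elimination"
    "Jordan_Normal_Form.Determinant"
begin

text \<open>The dimension varies in the limit, so a point of \<open>\<real>\<^sup>n\<close> is a function on \<open>nat\<close> of
  which the coordinates \<open>1, \<dots>, n\<close> matter, and Lebesgue measure is the product
  \<open>\<Pi>\<^sub>M i\<in>{1..n}. lborel\<close>. Vectors and matrices count from \<open>0\<close>: coordinate \<open>i\<close> sits at
  position \<open>i - 1\<close>.\<close>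

definition vec_of_point :: "nat \<Rightarrow> (nat \<Rightarrow> real) \<Rightarrow> real vec"
  where "vec_of_point n x = vec n (\<lambda>k. x (Suc k))"

text \<open>Only meaningful for an invertible (positive definite) covariance matrix \<open>S\<close>; see
  \<open>equicorrelation_inverse\<close> and \<open>marginal_covariance_inverse_det\<close> below.\<close>

definition mvn_density :: "nat \<Rightarrow> real vec \<Rightarrow> real mat \<Rightarrow> (nat \<Rightarrow> real) \<Rightarrow> real"
  where "mvn_density n \<mu> S x =
    (let v = vec_of_point n x - \<mu>
     in exp (- (v \<bullet> (the (mat_inverse S) *\<^sub>v v)) / 2) / sqrt ((2 * pi) ^ n * Determinant.det S))"

definition mvn :: "nat \<Rightarrow> real vec \<Rightarrow> real mat \<Rightarrow> (nat \<Rightarrow> real) measure"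
  where "mvn n \<mu> S =
    density (\<Pi>\<^sub>M i\<in>{1..n}. lborel) (\<lambda>x. ennreal (mvn_density n \<mu> S x))"

definition equicorrelation :: "nat \<Rightarrow> real \<Rightarrow> real mat"
  where "equicorrelation n \<rho> = mat n n (\<lambda>(j, k). if j = k then 1 else \<rho>)"

text \<open>Model \<open>0\<close> is the null model; model \<open>i \<in> {1..n}\<close> has mean \<open>\<theta>\<close> in coordinate \<open>i\<close> and
  \<open>0\<close> elsewhere, with \<open>\<theta>\<close> distributed as \<open>N(0, \<tau>\<^sup>2)\<close>. (The excluded value \<open>\<theta> = 0\<close> is a null
  set of this prior.)\<close>

definition marginal_density :: "nat \<Rightarrow> real \<Rightarrow> real \<Rightarrow> nat \<Rightarrow> (nat \<Rightarrow> real) \<Rightarrow> real"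
  where "marginal_density n \<rho> \<tau> i x =
    (if i = 0 then mvn_density n (0\<^sub>v n) (equicorrelation n \<rho>) x
     else (\<integral>\<theta>. mvn_density n (\<theta> \<cdot>\<^sub>v unit_vec n (i - 1)) (equicorrelation n \<rho>) x
                * normal_density 0 \<tau> \<theta> \<partial>lborel))"

definition prior_prob :: "nat \<Rightarrow> real \<Rightarrow> nat \<Rightarrow> real"
  where "prior_prob n r i = (if i = 0 then r else (1 - r) / real n)"

definition posterior_prob ::
    "nat \<Rightarrow> real \<Rightarrow> real \<Rightarrow> real \<Rightarrow> nat \<Rightarrow> (nat \<Rightarrow> real) \<Rightarrow> real"
  where "posterior_prob n r \<rho> \<tau> i x =
    marginal_density n \<rho> \<tau> i x * prior_prob n r i
      / (\<Sum>j=0..n. marginal_density n \<rho> \<tau> j x * prior_prob n r j)"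

text \<open>A false positive occurs when some non-null model passes the threshold. For \<open>p < 1/2\<close>
  this includes samples at which the null model passes as well.\<close>

definition false_positive_prob :: "nat \<Rightarrow> real \<Rightarrow> real \<Rightarrow> real \<Rightarrow> real \<Rightarrow> real"
  where "false_positive_prob n r \<rho> \<tau> p =
    (let M = mvn n (0\<^sub>v n) (equicorrelation n \<rho>)
     in measure M {x \<in> space M. \<exists>i\<in>{1..n}. posterior_prob n r \<rho> \<tau> i x > p})"


text \<open>The marginal density of model \<open>i\<close> is that of \<open>N(0, \<Sigma>\<^sub>i)\<close>, where \<open>\<Sigma>\<^sub>i\<close> is
  \<open>equicorrelation n \<rho>\<close> with its \<open>i\<close>-th diagonal entry replaced by \<open>1 + \<tau>\<^sup>2\<close>.\<close>

definition marginal_covariance :: "nat \<Rightarrow> real \<Rightarrow> real \<Rightarrow> nat \<Rightarrow> real mat"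
  where "marginal_covariance n \<rho> \<tau> i =
    mat n n (\<lambda>(j, k). if j = k then (if j = i - 1 then 1 + \<tau>\<^sup>2 else 1) else \<rho>)"

lemma mat_inverse_eqI:
  fixes S B :: "real mat"
  assumes S: "S \<in> carrier_mat n n" and B: "B \<in> carrier_mat n n" and SB: "S * B = 1\<^sub>m n"
  shows "mat_inverse S = Some B"
proof -
  have BS: "B * S = 1\<^sub>m n"
    using mat_mult_left_right_inverse[OF S B SB] .
  have "S \<in> Units (ring_mat TYPE(real) n ())"
    using S B SB BS by (auto simp: Units_def ring_mat_def)
  then obtain C where C: "mat_inverse S = Some C"
    using mat_inverse(1)[OF S, of "()"] by (cases "mat_inverse S") auto
  from mat_inverse(2)[OF S C] have C': "C * S = 1\<^sub>m n" "C \<in> carrier_mat n n" by auto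
  have "C = C * (S * B)" using SB C' by simp
  also have "\<dots> = B" using C' S B by (simp add: assoc_mult_mat[symmetric])
  finally show ?thesis using C by simp
qed

lemma equicorrelation_inverse:
  assumes "0 \<le> \<rho>" "\<rho> < 1"
  shows "mat_inverse (equicorrelation n \<rho>) =
    Some (mat n n (\<lambda>(j, k). (if j = k then 1 / (1 - \<rho>) else 0)
            - \<rho> / ((1 - \<rho>) * (1 + (real n - 1) * \<rho>))))"
proof (rule mat_inverse_eqI)
  let ?c = "\<rho> / ((1 - \<rho>) * (1 + (real n - 1) * \<rho>))"
  let ?B = "mat n n (\<lambda>(j, k). (if j = k then 1 / (1 - \<rho>) else 0) - ?c)"
  show "equicorrelation n \<rho> \<in> carrier_mat n n" "?B \<in> carrier_mat n n"
    by (auto simp: equicorrelation_def)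
  show "equicorrelation n \<rho> * ?B = 1\<^sub>m n"
  proof (rule eq_matI)
    fix j k assume "j < dim_row (1\<^sub>m n :: real mat)" "k < dim_col (1\<^sub>m n :: real mat)"
    hence jk: "j < n" "k < n" by auto
    have pos: "1 - \<rho> \<noteq> 0" "1 + (real n - 1) * \<rho> \<noteq> 0"
    proof -
      have "real n \<ge> 1" using jk by simp
      then have "(real n - 1) * \<rho> \<ge> 0" using assms by simp
      then show "1 + (real n - 1) * \<rho> \<noteq> 0" by linarith
    qed (use assms in auto)
    have "(equicorrelation n \<rho> * ?B) $$ (j, k) =
      (\<Sum>l<n. (if j = l then 1 else \<rho>) * ((if l = k then 1 / (1 - \<rho>) else 0) - ?c))"
      using jk by (simp add: equicorrelation_def scalar_prod_def lessThan_atLeast0)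
    also have "\<dots> = (\<Sum>l<n. (if j = l then 1 - \<rho> else 0) * (if l = k then 1 / (1 - \<rho>) else 0)
        + (if l = k then \<rho> / (1 - \<rho>) else 0) - (if l = j then (1 - \<rho>) * ?c else 0) - \<rho> * ?c)"
    proof (intro sum.cong refl)
      fix l
      have "(if j = l then 1 else \<rho>) * ((if l = k then d else 0) - c)
          = (if j = l then 1 - \<rho> else 0) * (if l = k then d else 0)
            + (if l = k then e else 0) - (if l = j then (1 - \<rho>) * c else 0) - \<rho> * c"
        if "\<rho> * d = e" for c d e
        using that by (auto simp: algebra_simps)
      then show "(if j = l then 1 else \<rho>) * ((if l = k then 1 / (1 - \<rho>) else 0) - ?c)
        = (if j = l then 1 - \<rho> else 0) * (if l = k then 1 / (1 - \<rho>) else 0)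
        + (if l = k then \<rho> / (1 - \<rho>) else 0) - (if l = j then (1 - \<rho>) * ?c else 0) - \<rho> * ?c"
        by simp
    qed
    also have "\<dots> = (if j = k then 1 else 0) + \<rho> / (1 - \<rho>) - (1 - \<rho>) * ?c - real n * (\<rho> * ?c)"
      using jk pos by (auto simp: sum.distrib sum_subtractf if_distrib[of "\<lambda>x. x * _"]
          sum.delta cong: if_cong)
    also have "\<dots> = (if j = k then 1 else 0)"
    proof -
      have "(1 - \<rho>) * c + real n * (\<rho> * c) = (1 + (real n - 1) * \<rho>) * c" for c
        by (simp add: algebra_simps)
      then have "(1 - \<rho>) * ?c + real n * (\<rho> * ?c) = (1 + (real n - 1) * \<rho>) * ?c" .
      also have "\<dots> = \<rho> / (1 - \<rho>)" using pos by simp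
      finally show ?thesis by simp
    qed
    finally show "(equicorrelation n \<rho> * ?B) $$ (j, k) = 1\<^sub>m n $$ (j, k)"
      using jk by simp
  qed (auto simp: equicorrelation_def)
qed

lemma marginal_covariance_inverse_det:
  fixes \<rho> \<tau> :: real and n i :: nat
  defines "B \<equiv> the (mat_inverse (equicorrelation n \<rho>))"
  defines "b \<equiv> B $$ (i - 1, i - 1)"
  assumes rho: "0 \<le> \<rho>" "\<rho> < 1" and i: "i \<in> {1..n}"
  shows "b > 0"
    and "B \<in> carrier_mat n n"
    and "\<And>j k. j < n \<Longrightarrow> k < n \<Longrightarrow> B $$ (j, k) = B $$ (k, j)"
    and "mat_inverse (marginal_covariance n \<rho> \<tau> i) =
      Some (mat n n (\<lambda>(j, k). B $$ (j, k)
        - \<tau>\<^sup>2 / (1 + \<tau>\<^sup>2 * b) * B $$ (j, i - 1) * B $$ (i - 1, k)))"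
    and "Determinant.det (marginal_covariance n \<rho> \<tau> i) =
      Determinant.det (equicorrelation n \<rho>) * (1 + \<tau>\<^sup>2 * b)"
proof -
  let ?S = "equicorrelation n \<rho>" and ?T = "marginal_covariance n \<rho> \<tau> i" and ?i = "i - 1"
  have i': "?i < n" and n1: "real n \<ge> 1" using i by auto
  have S: "?S \<in> carrier_mat n n" and T: "?T \<in> carrier_mat n n"
    by (auto simp: equicorrelation_def marginal_covariance_def)
  have Bdef: "B = mat n n (\<lambda>(j, k). (if j = k then 1 / (1 - \<rho>) else 0)
            - \<rho> / ((1 - \<rho>) * (1 + (real n - 1) * \<rho>)))"
    unfolding B_def equicorrelation_inverse[OF rho] by simp
  show B: "B \<in> carrier_mat n n" by (simp add: Bdef)
  show sym: "\<And>j k. j < n \<Longrightarrow> k < n \<Longrightarrow> B $$ (j, k) = B $$ (k, j)"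
    by (simp add: Bdef)
  have SB: "?S * B = 1\<^sub>m n" "B * ?S = 1\<^sub>m n"
    using mat_inverse(2)[OF S equicorrelation_inverse[OF rho]] by (simp_all add: Bdef)
  show b: "b > 0"
  proof -
    have p: "(real n - 1) * \<rho> \<ge> 0" using rho n1 by simp
    then have p1: "1 + (real n - 1) * \<rho> > 0" by linarith
    have "\<rho> < 1 + (real n - 1) * \<rho>" using p rho by linarith
    then have "\<rho> / (1 + (real n - 1) * \<rho>) < 1" using p1 by simp
    then have "\<rho> / (1 + (real n - 1) * \<rho>) / (1 - \<rho>) < 1 / (1 - \<rho>)"
      using rho by (intro divide_strict_right_mono) auto
    then show ?thesis using i' by (simp add: b_def Bdef mult.commute)
  qed
  have b1: "1 + \<tau>\<^sup>2 * b > 0" using b by (simp add: add_pos_nonneg)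
  define \<kappa> where "\<kappa> = \<tau>\<^sup>2 / (1 + \<tau>\<^sup>2 * b)"
  let ?C = "mat n n (\<lambda>(j, k). B $$ (j, k) - \<kappa> * B $$ (j, ?i) * B $$ (?i, k))"
  have Tentry: "?T $$ (j, k) = ?S $$ (j, k) + (if j = ?i \<and> k = ?i then \<tau>\<^sup>2 else 0)"
    if "j < n" "k < n" for j k
    using that by (simp add: equicorrelation_def marginal_covariance_def)
  have SBentry: "(\<Sum>l<n. ?S $$ (j, l) * B $$ (l, k)) = (if j = k then 1 else 0)"
    if "j < n" "k < n" for j k
  proof -
    have "(?S * B) $$ (j, k) = (\<Sum>l<n. ?S $$ (j, l) * B $$ (l, k))"
      using that S B by (simp add: scalar_prod_def lessThan_atLeast0)
    then show ?thesis using that by (simp add: SB)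
  qed
  have "mat_inverse ?T = Some ?C"
  proof (rule mat_inverse_eqI[OF T])
    show "?T * ?C = 1\<^sub>m n"
    proof (rule eq_matI)
      fix j k assume "j < dim_row (1\<^sub>m n :: real mat)" "k < dim_col (1\<^sub>m n :: real mat)"
      hence jk: "j < n" "k < n" by auto
      have "(?T * ?C) $$ (j, k) = (\<Sum>l<n. ?T $$ (j, l) * ?C $$ (l, k))"
        using jk T by (simp add: scalar_prod_def lessThan_atLeast0)
      also have "\<dots> = (\<Sum>l<n. ?S $$ (j, l) * B $$ (l, k)
          - (\<kappa> * B $$ (?i, k)) * (?S $$ (j, l) * B $$ (l, ?i))
          + (if l = ?i then (if j = ?i then \<tau>\<^sup>2 * (B $$ (?i, k) - \<kappa> * b * B $$ (?i, k)) else 0) else 0))"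
        by (intro sum.cong refl) (use jk in \<open>simp add: Tentry b_def algebra_simps\<close>)
      also have "\<dots> = (\<Sum>l<n. ?S $$ (j, l) * B $$ (l, k))
          - (\<kappa> * B $$ (?i, k)) * (\<Sum>l<n. ?S $$ (j, l) * B $$ (l, ?i))
          + (if j = ?i then \<tau>\<^sup>2 * (B $$ (?i, k) - \<kappa> * b * B $$ (?i, k)) else 0)"
        using i' by (simp add: sum.distrib sum_subtractf sum_distrib_left)
      also have "\<dots> = (if j = k then 1 else 0)
          + (if j = ?i then B $$ (?i, k) * (\<tau>\<^sup>2 * (1 - \<kappa> * b) - \<kappa>) else 0)"
        using SBentry[OF jk] SBentry[OF jk(1) i'] by (simp add: algebra_simps)
      also have "\<tau>\<^sup>2 * (1 - \<kappa> * b) - \<kappa> = 0"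
      proof -
        have "\<kappa> * (1 + \<tau>\<^sup>2 * b) = \<tau>\<^sup>2" using b1 by (simp add: \<kappa>_def)
        then show ?thesis by (simp add: algebra_simps)
      qed
      finally show "(?T * ?C) $$ (j, k) = 1\<^sub>m n $$ (j, k)" using jk by simp
    qed (use T in auto)
  qed simp
  then show "mat_inverse ?T =
      Some (mat n n (\<lambda>(j, k). B $$ (j, k)
        - \<tau>\<^sup>2 / (1 + \<tau>\<^sup>2 * b) * B $$ (j, i - 1) * B $$ (i - 1, k)))"
    by (simp only: \<kappa>_def)
  show "Determinant.det ?T = Determinant.det ?S * (1 + \<tau>\<^sup>2 * b)"
  proof -
    have cof: "cofactor ?T ?i j = cofactor ?S ?i j" for j
    proof -
      have "mat_delete ?T ?i j = mat_delete ?S ?i j"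
        by (rule eq_matI)
          (auto simp: mat_delete_def marginal_covariance_def equicorrelation_def)
      then show ?thesis by (simp add: cofactor_def)
    qed
    have "Determinant.det ?T = (\<Sum>j<n. ?T $$ (?i, j) * cofactor ?T ?i j)"
      by (rule laplace_expansion_row[OF T i'])
    also have "\<dots> = (\<Sum>j<n. ?S $$ (?i, j) * cofactor ?S ?i j
        + (if j = ?i then \<tau>\<^sup>2 * cofactor ?S ?i ?i else 0))"
      by (intro sum.cong refl) (use i' in \<open>simp add: Tentry cof[unfolded One_nat_def] algebra_simps\<close>)
    also have "\<dots> = Determinant.det ?S + \<tau>\<^sup>2 * cofactor ?S ?i ?i"
      using i' laplace_expansion_row[OF S i'] by (simp add: sum.distrib)
    also have "cofactor ?S ?i ?i = Determinant.det ?S * b"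
    proof -
      note adj = adj_mat[OF S]
      have "adj_mat ?S = adj_mat ?S * (?S * B)" using SB adj by simp
      also have "\<dots> = (Determinant.det ?S \<cdot>\<^sub>m 1\<^sub>m n) * B"
        using adj S B by (simp add: assoc_mult_mat[symmetric])
      also have "\<dots> = Determinant.det ?S \<cdot>\<^sub>m B"
        using B by (simp add: mult_smult_assoc_mat[of _ n n _ n])
      finally have "adj_mat ?S $$ (?i, ?i) = Determinant.det ?S * b"
        using i' B by (simp add: b_def)
      then show ?thesis using i' S by (simp add: adj_mat_def)
    qed
    finally show ?thesis by (simp add: algebra_simps)
  qed
qed

lemma mvn_density_altdef:
  assumes "mat_inverse S = Some C" "C \<in> carrier_mat n n" "\<mu> \<in> carrier_vec n"
  shows "mvn_density n \<mu> S x =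
    exp (- (\<Sum>j<n. \<Sum>k<n. C $$ (j, k) * (x (Suc j) - \<mu> $ j) * (x (Suc k) - \<mu> $ k)) / 2)
      / sqrt ((2 * pi) ^ n * Determinant.det S)"
proof -
  have "(vec_of_point n x - \<mu>) \<bullet> (C *\<^sub>v (vec_of_point n x - \<mu>)) =
    (\<Sum>j<n. \<Sum>k<n. C $$ (j, k) * (x (Suc j) - \<mu> $ j) * (x (Suc k) - \<mu> $ k))"
    using assms(2,3)
    by (auto simp: scalar_prod_def vec_of_point_def lessThan_atLeast0 sum_distrib_left mult_ac
        intro!: sum.cong)
  then show ?thesis using assms(1) by (simp add: mvn_density_def Let_def)
qed

theorem marginal_density_eq:
  assumes rho: "0 \<le> \<rho>" "\<rho> < 1" and i: "i \<in> {1..n}" and tau: "\<tau>\<^sup>2 > 0"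
  shows "marginal_density n \<rho> \<tau> i x = mvn_density n (0\<^sub>v n) (marginal_covariance n \<rho> \<tau> i) x"
proof -
  let ?S = "equicorrelation n \<rho>" and ?T = "marginal_covariance n \<rho> \<tau> i" and ?i = "i - 1"
  define B where "B = the (mat_inverse ?S)"
  define b where "b = B $$ (?i, ?i)"
  define \<kappa> where "\<kappa> = \<tau>\<^sup>2 / (1 + \<tau>\<^sup>2 * b)"
  note * = marginal_covariance_inverse_det[OF rho i, folded B_def, folded b_def]
  note b = *(1) and B = *(2) and sym = *(3) and inv = *(4)[of \<tau>, folded \<kappa>_def] and det = *(5)[of \<tau>]
  have i': "?i < n" using i by auto
  have b1: "1 + \<tau>\<^sup>2 * b > 0" using b by (simp add: add_pos_nonneg)
  have \<kappa>: "\<kappa> > 0" using tau b1 by (simp add: \<kappa>_def)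
  have \<kappa>inv: "1 / \<kappa> = b + 1 / \<tau>\<^sup>2"
    using tau b1 by (simp add: \<kappa>_def field_simps)
  have invS: "mat_inverse ?S = Some B"
    by (simp add: B_def equicorrelation_inverse[OF rho])
  let ?D = "sqrt ((2 * pi) ^ n * Determinant.det ?S)"
  define q where "q = (\<Sum>j<n. \<Sum>k<n. B $$ (j, k) * x (Suc j) * x (Suc k))"
  define a where "a = (\<Sum>k<n. B $$ (?i, k) * x (Suc k))"
  have a': "a = (\<Sum>j<n. B $$ (j, ?i) * x (Suc j))"
    unfolding a_def using sym[OF _ i'] by (intro sum.cong refl) (metis lessThan_iff)
  have lik: "mvn_density n (\<theta> \<cdot>\<^sub>v unit_vec n ?i) ?S x = exp (- (q - 2 * \<theta> * a + \<theta>\<^sup>2 * b) / 2) / ?D" for \<theta>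
  proof -
    let ?e = "\<lambda>j. if j = ?i then \<theta> else 0"
    have "(\<Sum>j<n. \<Sum>k<n. B $$ (j, k) * (x (Suc j) - (\<theta> \<cdot>\<^sub>v unit_vec n ?i) $ j)
           * (x (Suc k) - (\<theta> \<cdot>\<^sub>v unit_vec n ?i) $ k))
       = (\<Sum>j<n. \<Sum>k<n. B $$ (j, k) * x (Suc j) * x (Suc k)
           - (if k = ?i then \<theta> * (B $$ (j, ?i) * x (Suc j)) else 0)
           - (if j = ?i then \<theta> * (B $$ (?i, k) * x (Suc k)) else 0)
           + (if k = ?i then (if j = ?i then \<theta>\<^sup>2 * b else 0) else 0))"
      by (intro sum.cong refl) (auto simp: b_def unit_vec_def algebra_simps power2_eq_square)
    also have "\<dots> = (\<Sum>j<n. (\<Sum>k<n. B $$ (j, k) * x (Suc j) * x (Suc k))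
           - \<theta> * (B $$ (j, ?i) * x (Suc j))
           - (if j = ?i then \<theta> * a else 0)
           + (if j = ?i then \<theta>\<^sup>2 * b else 0))"
      by (intro sum.cong refl)
        (use i' in \<open>auto simp: sum.distrib sum_subtractf a_def sum_distrib_left\<close>)
    also have "\<dots> = q - \<theta> * a - \<theta> * a + \<theta>\<^sup>2 * b"
      using i' unfolding a' q_def
      by (simp add: sum.distrib sum_subtractf sum_distrib_left)
    finally show ?thesis
      by (subst mvn_density_altdef[OF invS B]) (simp_all add: algebra_simps)
  qed
  have marg: "mvn_density n (0\<^sub>v n) ?T x
      = exp (- (q - \<kappa> * a\<^sup>2) / 2) / sqrt ((2 * pi) ^ n * Determinant.det ?T)"
  proof -
    have "(\<Sum>j<n. \<Sum>k<n. (B $$ (j, k) - \<kappa> * B $$ (j, ?i) * B $$ (?i, k)) * x (Suc j) * x (Suc k))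
       = q - \<kappa> * ((\<Sum>j<n. B $$ (j, ?i) * x (Suc j)) * (\<Sum>k<n. B $$ (?i, k) * x (Suc k)))"
      unfolding q_def sum_product unfolding sum_distrib_left sum_subtractf[symmetric]
      by (intro sum.cong refl) (simp add: algebra_simps)
    also have "\<dots> = q - \<kappa> * a\<^sup>2" by (simp only: a'[symmetric] a_def[symmetric] power2_eq_square)
    finally show ?thesis
      by (subst mvn_density_altdef[OF inv]) simp_all
  qed
  have D: "sqrt ((2 * pi) ^ n * Determinant.det ?T) = ?D * sqrt (1 + \<tau>\<^sup>2 * b)"
    by (simp add: det real_sqrt_mult)
  have "mvn_density n (\<theta> \<cdot>\<^sub>v unit_vec n ?i) ?S x * normal_density 0 \<tau> \<theta>
      = exp (- (q - \<kappa> * a\<^sup>2) / 2) / (?D * sqrt (1 + \<tau>\<^sup>2 * b)) * normal_density (\<kappa> * a) (sqrt \<kappa>) \<theta>" for \<theta>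
  proof -
    have ex: "- (q - 2 * \<theta> * a + \<theta>\<^sup>2 * b) / 2 + - \<theta>\<^sup>2 / (2 * \<tau>\<^sup>2)
        = - (q - \<kappa> * a\<^sup>2) / 2 + - (\<theta> - \<kappa> * a)\<^sup>2 / (2 * \<kappa>)"
    proof -
      have "- \<theta>\<^sup>2 / (2 * \<tau>\<^sup>2) = - \<theta>\<^sup>2 / 2 * (1 / \<kappa> - b)" by (simp add: \<kappa>inv)
      moreover have "- (\<theta> - \<kappa> * a)\<^sup>2 / (2 * \<kappa>) = - \<theta>\<^sup>2 / 2 * (1 / \<kappa>) + \<theta> * a - \<kappa> * a\<^sup>2 / 2"
        using \<kappa> by (simp add: field_simps power2_eq_square)
      ultimately show ?thesis by (simp add: algebra_simps diff_divide_distrib add_divide_distrib)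
    qed
    have "sqrt (2 * pi * \<tau>\<^sup>2) = sqrt (1 + \<tau>\<^sup>2 * b) * sqrt (2 * pi * \<kappa>)"
      using b1 by (simp add: real_sqrt_mult[symmetric] \<kappa>_def field_simps)
    then show ?thesis
      unfolding lik normal_density_def
      using ex \<kappa> by (simp add: exp_add[symmetric] mult_ac)
  qed
  then have "marginal_density n \<rho> \<tau> i x
      = exp (- (q - \<kappa> * a\<^sup>2) / 2) / (?D * sqrt (1 + \<tau>\<^sup>2 * b))
        * (\<integral>\<theta>. normal_density (\<kappa> * a) (sqrt \<kappa>) \<theta> \<partial>lborel)"
    using i by (simp add: marginal_density_def)
  also have "(\<integral>\<theta>. normal_density (\<kappa> * a) (sqrt \<kappa>) \<theta> \<partial>lborel) = 1"
    using \<kappa> by simp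
  finally show ?thesis by (simp only: marg D mult_1_right)
qed

lemma false_positive_event_measurable:
  assumes rho: "0 \<le> \<rho>" "\<rho> < 1" and tau: "\<tau>\<^sup>2 > 0"
  shows "{x \<in> space (mvn n (0\<^sub>v n) (equicorrelation n \<rho>)).
      \<exists>i\<in>{1..n}. posterior_prob n r \<rho> \<tau> i x > p} \<in> sets (mvn n (0\<^sub>v n) (equicorrelation n \<rho>))"
proof -
  let ?L = "\<Pi>\<^sub>M i\<in>{1..n}. (lborel :: real measure)"
  have dens: "mvn_density n (0\<^sub>v n) S \<in> borel_measurable ?L"
    if "mat_inverse S = Some C" "C \<in> carrier_mat n n" for S C
  proof -
    have "mvn_density n (0\<^sub>v n) S = (\<lambda>x.
        exp (- (\<Sum>j<n. \<Sum>k<n. C $$ (j, k) * x (Suc j) * x (Suc k)) / 2)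
          / sqrt ((2 * pi) ^ n * Determinant.det S))"
      by (rule ext, subst mvn_density_altdef[OF that]) simp_all
    also have "\<dots> \<in> borel_measurable ?L"
    proof -
      have [measurable]: "(\<lambda>x. x (Suc j)) \<in> borel_measurable ?L" if "j < n" for j
        using measurable_component_singleton[of "Suc j" "{1..n}" "\<lambda>_. lborel"] that by simp
      show ?thesis by measurable
    qed
    finally show ?thesis .
  qed
  have marg: "marginal_density n \<rho> \<tau> i \<in> borel_measurable ?L" if "i \<le> n" for i
  proof (cases "i = 0")
    case True
    have "marginal_density n \<rho> \<tau> i = mvn_density n (0\<^sub>v n) (equicorrelation n \<rho>)"
      using True by (simp add: marginal_density_def fun_eq_iff)
    then show ?thesis using dens[OF equicorrelation_inverse[OF rho]] by simp
  next
    case False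
    then have i: "i \<in> {1..n}" using that by simp
    have "marginal_density n \<rho> \<tau> i = mvn_density n (0\<^sub>v n) (marginal_covariance n \<rho> \<tau> i)"
      using marginal_density_eq[OF rho i tau] by (simp add: fun_eq_iff)
    then show ?thesis
      using dens[OF marginal_covariance_inverse_det(4)[OF rho i]] by simp
  qed
  have [measurable]: "posterior_prob n r \<rho> \<tau> i \<in> borel_measurable ?L" if "i \<le> n" for i
  proof -
    have "(\<lambda>x. marginal_density n \<rho> \<tau> i x * prior_prob n r i
      / (\<Sum>j=0..n. marginal_density n \<rho> \<tau> j x * prior_prob n r j)) \<in> borel_measurable ?L"
      using that by (intro borel_measurable_divide borel_measurable_times borel_measurable_sum marg
          borel_measurable_const) auto
    then show ?thesis by (simp add: posterior_prob_def[abs_def])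
  qed
  have "{x \<in> space ?L. \<exists>i\<in>{1..n}. posterior_prob n r \<rho> \<tau> i x > p} \<in> sets ?L"
    by measurable
  then show ?thesis by (simp add: mvn_def)
qed

end

theory Submission
  imports Defs "HOL-Real_Asymp.Real_Asymp"
begin

text \<open>
  The proof is a union bound over the \<open>n\<close> alternatives, and it rests on one observation: the
  evidence for model \<open>i\<close> depends on the sample only through the residual \<open>z\<close> of coordinate \<open>i\<close>
  after regression on the other coordinates. Writing \<open>s\<close> for the conditional variance of
  \<open>X\<^sub>i\<close> given the rest under the null model, the likelihood ratio is
  \<open>m\<^sub>i / m\<^sub>0 = sqrt (s / (s + \<tau>\<^sup>2)) * exp (\<tau>\<^sup>2 z\<^sup>2 / (2 s (s + \<tau>\<^sup>2)))\<close>
  (\<open>marginal_density_ratio\<close>), and under the null model \<open>z\<close> is exactly \<open>N(0, s)\<close>.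

  Keeping only the null term in the denominator of the posterior, acceptance of model \<open>i\<close>
  forces \<open>m\<^sub>i / m\<^sub>0 > C n\<close> with \<open>C = p r / (1 - r)\<close>, that is
  \<open>z\<^sup>2 / s > 2 (1 + s / \<tau>\<^sup>2) ln (C n)\<close>. Since \<open>s \<ge> 1 - \<rho>\<close>, the standardised residual
  exceeds \<open>u = sqrt (2 (1 + \<alpha>) ln (C n))\<close> in absolute value, where \<open>\<alpha> = (1 - \<rho>) / \<tau>\<^sup>2\<close>
  (\<open>posterior_threshold_imp_large_residual\<close>). The Gaussian tail at \<open>u\<close> is at most
  \<open>2 exp (- u\<^sup>2 / 2) / (u sqrt (2 \<pi>))\<close>, which is of order
  \<open>n\<^sup>-\<^sup>1\<^sup>-\<^sup>\<alpha> (ln n)\<^sup>-\<^sup>1\<^sup>/\<^sup>2\<close>; the \<open>n\<close> terms of the union bound cancel one factor \<open>n\<close>.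

  The law of the residual comes from factoring the null density as a conditional normal
  density of one coordinate times the null density of the others
  (\<open>equicor_density_insert\<close>). The same factorisation, iterated, shows that the null density has
  total mass \<open>1\<close>, so no change of variables in \<open>n\<close> dimensions is involved.
\<close>

section \<open>The equicorrelated normal density, one coordinate at a time\<close>

text \<open>The eigenvalue of the equicorrelation matrix of size \<open>m\<close> at the constant vector; all other
  eigenvalues are \<open>1 - \<rho>\<close>. Its value \<open>1 - \<rho>\<close> at \<open>m = 0\<close> makes the recursions below start
  correctly at the empty index set.\<close>

definition top_eigenvalue :: "real \<Rightarrow> nat \<Rightarrow> real"
  where "top_eigenvalue \<rho> m = 1 + (real m - 1) * \<rho>"

text \<open>The mean and the variance (\<open>cond_var \<rho> (card I)\<close>) of a further coordinate given those
  in \<open>I\<close>.\<close>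

definition cond_mean :: "real \<Rightarrow> 'a set \<Rightarrow> ('a \<Rightarrow> real) \<Rightarrow> real"
  where "cond_mean \<rho> I x = \<rho> * sum x I / top_eigenvalue \<rho> (card I)"

definition cond_var :: "real \<Rightarrow> nat \<Rightarrow> real"
  where "cond_var \<rho> m = (1 - \<rho>) * top_eigenvalue \<rho> (Suc m) / top_eigenvalue \<rho> m"

definition equicor_det :: "real \<Rightarrow> nat \<Rightarrow> real"
  where "equicor_det \<rho> m = (1 - \<rho>) ^ m * top_eigenvalue \<rho> m / (1 - \<rho>)"

text \<open>The inverse and the determinant of the covariance matrix are written out, and the
  coordinates are indexed by an arbitrary finite set: removing coordinate \<open>i\<close> from
  \<open>{1..n}\<close> then leaves a density of the same form.\<close>

definition equicor_density :: "real \<Rightarrow> 'a set \<Rightarrow> ('a \<Rightarrow> real) \<Rightarrow> real"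
  where "equicor_density \<rho> I x =
    exp (- ((\<Sum>i\<in>I. (x i)\<^sup>2) / (1 - \<rho>)
            - \<rho> / ((1 - \<rho>) * top_eigenvalue \<rho> (card I)) * (sum x I)\<^sup>2) / 2)
      / sqrt ((2 * pi) ^ card I * equicor_det \<rho> (card I))"

lemma top_eigenvalue_pos:
  assumes "0 \<le> \<rho>" "\<rho> < 1"
  shows "top_eigenvalue \<rho> m > 0"
proof -
  have "top_eigenvalue \<rho> m = (1 - \<rho>) + real m * \<rho>"
    by (simp add: top_eigenvalue_def algebra_simps)
  with assms show ?thesis by (simp add: add_pos_nonneg)
qed

lemma top_eigenvalue_Suc: "top_eigenvalue \<rho> (Suc m) = top_eigenvalue \<rho> m + \<rho>"
  by (simp add: top_eigenvalue_def algebra_simps)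

lemma cond_var_lower_bound:
  assumes "0 \<le> \<rho>" "\<rho> < 1"
  shows "1 - \<rho> \<le> cond_var \<rho> m" "cond_var \<rho> m > 0"
proof -
  note e = top_eigenvalue_pos[OF assms, of m]
  have "(1 - \<rho>) * 1 \<le> (1 - \<rho>) * ((top_eigenvalue \<rho> m + \<rho>) / top_eigenvalue \<rho> m)"
    using assms e by (intro mult_left_mono) auto
  then show "1 - \<rho> \<le> cond_var \<rho> m" by (simp add: cond_var_def top_eigenvalue_Suc)
  with assms show "cond_var \<rho> m > 0" by linarith
qed

text \<open>The left-hand side is a diagonal entry of the inverse of the equicorrelation matrix of size
  \<open>Suc m\<close>: as for every Gaussian vector, it is the reciprocal of the variance of that coordinate
  given the others.\<close>

lemma inverse_cond_var:
  assumes "0 \<le> \<rho>" "\<rho> < 1"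
  shows "1 / (1 - \<rho>) - \<rho> / ((1 - \<rho>) * top_eigenvalue \<rho> (Suc m)) = 1 / cond_var \<rho> m"
proof -
  have "1 / (1 - \<rho>) = top_eigenvalue \<rho> (Suc m) / ((1 - \<rho>) * top_eigenvalue \<rho> (Suc m))"
    using top_eigenvalue_pos[OF assms, of "Suc m"] by simp
  then have "1 / (1 - \<rho>) - \<rho> / ((1 - \<rho>) * top_eigenvalue \<rho> (Suc m))
      = (top_eigenvalue \<rho> (Suc m) - \<rho>) / ((1 - \<rho>) * top_eigenvalue \<rho> (Suc m))"
    by (simp only: diff_divide_distrib)
  then show ?thesis
    by (simp add: cond_var_def top_eigenvalue_Suc)
qed

lemma equicor_det_Suc:
  assumes "0 \<le> \<rho>" "\<rho> < 1"
  shows "equicor_det \<rho> (Suc m) = equicor_det \<rho> m * cond_var \<rho> m"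
  using top_eigenvalue_pos[OF assms, of m] assms
  by (simp add: equicor_det_def cond_var_def)

text \<open>Completing the square in the new coordinate: joint density equals conditional density
  times marginal density.\<close>

lemma equicor_density_insert:
  fixes x :: "'a \<Rightarrow> real"
  assumes rho: "0 \<le> \<rho>" "\<rho> < 1" and I: "finite I" "i \<notin> I"
  shows "equicor_density \<rho> (insert i I) (x(i := y)) =
    normal_density (cond_mean \<rho> I x) (sqrt (cond_var \<rho> (card I))) y * equicor_density \<rho> I x"
proof -
  define e v S Q where "e = top_eigenvalue \<rho> (card I)" and "v = 1 - \<rho>"
    and "S = sum x I" and "Q = (\<Sum>i\<in>I. (x i)\<^sup>2)"
  have pos: "e > 0" "v > 0" "e + \<rho> > 0"
    using rho top_eigenvalue_pos[OF rho] by (auto simp: e_def v_def add_pos_nonneg)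
  define V D where "V = v * (e + \<rho>) / e" and "D = sqrt ((2 * pi) ^ card I * equicor_det \<rho> (card I))"
  have card': "card (insert i I) = Suc (card I)" using I by simp
  have S': "sum (x(i := y)) (insert i I) = S + y"
    and Q': "(\<Sum>j\<in>insert i I. ((x(i := y)) j)\<^sup>2) = Q + y\<^sup>2"
    unfolding S_def Q_def using I
    by (simp_all add: sum.insert, intro sum.cong, auto, intro sum.cong, auto)
  have V: "cond_var \<rho> (card I) = V" "V > 0"
    using pos by (simp_all add: V_def cond_var_def e_def v_def top_eigenvalue_Suc)
  have quadr: "(Q + y\<^sup>2) / v - \<rho> / (v * (e + \<rho>)) * (S + y)\<^sup>2
      = (Q / v - \<rho> / (v * e) * S\<^sup>2) + (y - \<rho> * S / e)\<^sup>2 / V"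
    unfolding V_def using pos
    by (simp add: divide_simps) (simp add: algebra_simps power2_eq_square)
  have half: "- a / 2 = - d / (2 * V) + - b / 2" if "a = b + d / V" for a b d :: real
    using that by (simp add: add_divide_distrib)
  have D': "sqrt ((2 * pi) ^ Suc (card I) * equicor_det \<rho> (Suc (card I))) = sqrt (2 * pi * V) * D"
    by (simp add: D_def equicor_det_Suc[OF rho] V(1) flip: real_sqrt_mult)
  have "equicor_density \<rho> (insert i I) (x(i := y))
      = exp (- ((Q + y\<^sup>2) / v - \<rho> / (v * (e + \<rho>)) * (S + y)\<^sup>2) / 2) / (sqrt (2 * pi * V) * D)"
    by (simp only: equicor_density_def S' Q' card' D' top_eigenvalue_Suc e_def v_def)
  also have "\<dots> = exp (- (y - \<rho> * S / e)\<^sup>2 / (2 * V)) / sqrt (2 * pi * V)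
      * (exp (- (Q / v - \<rho> / (v * e) * S\<^sup>2) / 2) / D)"
    unfolding half[OF quadr] exp_add by simp
  also have "exp (- (Q / v - \<rho> / (v * e) * S\<^sup>2) / 2) / D = equicor_density \<rho> I x"
    by (simp only: equicor_density_def S_def Q_def e_def v_def D_def)
  also have "exp (- (y - \<rho> * S / e)\<^sup>2 / (2 * V)) / sqrt (2 * pi * V)
      = normal_density (cond_mean \<rho> I x) (sqrt V) y"
    using V by (simp add: normal_density_def cond_mean_def S_def e_def)
  finally show ?thesis by (simp only: V(1))
qed

lemma borel_measurable_equicor_density [measurable]:
  "equicor_density \<rho> I \<in> borel_measurable (\<Pi>\<^sub>M i\<in>I. lborel)"
  unfolding equicor_density_def[abs_def] by measurable

lemma equicor_density_nonneg:
  assumes "0 \<le> \<rho>" "\<rho> < 1"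
  shows "equicor_density \<rho> I x \<ge> 0"
  using top_eigenvalue_pos[OF assms, of "card I"] assms
  by (simp add: equicor_density_def equicor_det_def)

text \<open>Integrate over coordinate \<open>i\<close> first: by the factorisation, translating by the conditional
  mean turns the inner integral into one that no longer depends on the other coordinates.\<close>

lemma nn_integral_equicor_residual:
  fixes i :: 'a and g :: "real \<Rightarrow> ennreal"
  assumes rho: "0 \<le> \<rho>" "\<rho> < 1" and I: "finite I" "i \<notin> I"
    and g [measurable]: "g \<in> borel_measurable borel"
  shows "(\<integral>\<^sup>+x. g (x i - cond_mean \<rho> I x) * equicor_density \<rho> (insert i I) x
             \<partial>(\<Pi>\<^sub>M i\<in>insert i I. lborel))
    = (\<integral>\<^sup>+z. g z * normal_density 0 (sqrt (cond_var \<rho> (card I))) z \<partial>lborel)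
      * (\<integral>\<^sup>+x. equicor_density \<rho> I x \<partial>(\<Pi>\<^sub>M i\<in>I. lborel))"
    (is "?L = ?G * _")
proof -
  interpret product_sigma_finite "\<lambda>_::'a. lborel :: real measure" ..
  let ?s = "sqrt (cond_var \<rho> (card I))"
  have [measurable]: "(\<lambda>x. cond_mean \<rho> I x) \<in> borel_measurable (\<Pi>\<^sub>M i\<in>insert i I. lborel)"
    unfolding cond_mean_def by measurable
  have upd: "cond_mean \<rho> I (x(i := y)) = cond_mean \<rho> I x" for x y
    using I(2) by (auto simp: cond_mean_def intro!: arg_cong2[of _ _ _ _ "(/)"] sum.cong)
  have inner: "(\<integral>\<^sup>+y. g (y - cond_mean \<rho> I x) * equicor_density \<rho> (insert i I) (x(i := y)) \<partial>lborel)
      = ?G * equicor_density \<rho> I x" for x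
  proof -
    have "(\<integral>\<^sup>+y. g (y - cond_mean \<rho> I x) * equicor_density \<rho> (insert i I) (x(i := y)) \<partial>lborel)
      = (\<integral>\<^sup>+y. g (y - cond_mean \<rho> I x) * normal_density (cond_mean \<rho> I x) ?s y
            * equicor_density \<rho> I x \<partial>lborel)"
      by (simp add: equicor_density_insert[OF rho I] ennreal_mult equicor_density_nonneg[OF rho] mult.assoc)
    also have "\<dots> = (\<integral>\<^sup>+y. g (y - cond_mean \<rho> I x) * normal_density (cond_mean \<rho> I x) ?s y \<partial>lborel)
            * equicor_density \<rho> I x"
      by (rule nn_integral_multc) measurable
    also have "(\<integral>\<^sup>+y. g (y - cond_mean \<rho> I x) * normal_density (cond_mean \<rho> I x) ?s y \<partial>lborel) = ?G"
      by (subst nn_integral_real_affine[where c = 1 and t = "cond_mean \<rho> I x"])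
         (simp_all add: normal_density_def)
    finally show ?thesis .
  qed
  have "?L = (\<integral>\<^sup>+x. (\<integral>\<^sup>+y. g (y - cond_mean \<rho> I x)
      * equicor_density \<rho> (insert i I) (x(i := y)) \<partial>lborel) \<partial>(\<Pi>\<^sub>M i\<in>I. lborel))"
    by (subst product_nn_integral_insert[OF I]) (simp_all add: upd)
  also have "\<dots> = ?G * (\<integral>\<^sup>+x. equicor_density \<rho> I x \<partial>(\<Pi>\<^sub>M i\<in>I. lborel))"
    unfolding inner by (rule nn_integral_cmult) measurable
  finally show ?thesis .
qed

lemma nn_integral_equicor_density:
  assumes rho: "0 \<le> \<rho>" "\<rho> < 1" and "finite I"
  shows "(\<integral>\<^sup>+x. equicor_density \<rho> I x \<partial>(\<Pi>\<^sub>M i\<in>I. lborel)) = 1"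
  using \<open>finite I\<close>
proof induction
  case empty
  interpret product_sigma_finite "\<lambda>_::'a. lborel :: real measure" ..
  show ?case
    using rho
    by (subst nn_integral_empty) (simp_all add: equicor_density_def equicor_det_def top_eigenvalue_def)
next
  case (insert i I)
  have "(\<integral>\<^sup>+z. normal_density 0 (sqrt (cond_var \<rho> (card I))) z \<partial>lborel) = 1"
    using cond_var_lower_bound(2)[OF rho, of "card I"]
    by (subst nn_integral_eq_integral) auto
  then show ?case
    using nn_integral_equicor_residual[OF rho insert.hyps, of "\<lambda>_. 1"] insert.IH by simp
qed

section \<open>Gaussian tails\<close>

text \<open>Mills' bound: beyond \<open>s\<close> the factor \<open>z / s\<close> is at least \<open>1\<close>, and inserting it makes the
  integrand an exact derivative.\<close>

lemma normal_upper_tail: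
  assumes "\<sigma> > 0" "s > 0"
  shows "(\<integral>\<^sup>+z. ennreal (normal_density 0 \<sigma> z) * indicator {s..} z \<partial>lborel)
    \<le> ennreal (\<sigma>\<^sup>2 / s * normal_density 0 \<sigma> s)"
proof -
  have "(\<integral>\<^sup>+z. ennreal (normal_density 0 \<sigma> z) * indicator {s..} z \<partial>lborel)
      \<le> (\<integral>\<^sup>+z. ennreal (z / s * normal_density 0 \<sigma> z) * indicator {s..} z \<partial>lborel)"
  proof (intro nn_integral_mono)
    fix z
    have "1 * normal_density 0 \<sigma> z \<le> z / s * normal_density 0 \<sigma> z" if "z \<ge> s"
      using that assms by (intro mult_right_mono) auto
    then show "ennreal (normal_density 0 \<sigma> z) * indicator {s..} z
        \<le> ennreal (z / s * normal_density 0 \<sigma> z) * indicator {s..} z"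
      by (auto simp: indicator_def intro!: ennreal_leI)
  qed
  also have "\<dots> = ennreal (0 - (- (\<sigma>\<^sup>2 / s * normal_density 0 \<sigma> s)))"
    \<comment> \<open>The antiderivative is fixed explicitly because unification could also read the factor
      \<open>\<sigma>\<^sup>2 / s\<close> as depending on the variable.\<close>
  proof (rule nn_integral_FTC_atLeast[where F = "\<lambda>z. - (\<sigma>\<^sup>2 / s * normal_density 0 \<sigma> z)"])
    define K where "K = 1 / sqrt (2 * pi * \<sigma>\<^sup>2)"
    have nd: "normal_density 0 \<sigma> = (\<lambda>z. K * exp (- z\<^sup>2 / (2 * \<sigma>\<^sup>2)))"
      by (simp add: normal_density_def K_def fun_eq_iff)
    have K: "K > 0" using assms by (simp add: K_def)
    show "((\<lambda>z. - (\<sigma>\<^sup>2 / s * normal_density 0 \<sigma> z)) has_real_derivative z / s * normal_density 0 \<sigma> z) (at z)"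
      for z
    proof -
      have "((\<lambda>z. - z\<^sup>2 / (2 * \<sigma>\<^sup>2)) has_real_derivative - z / \<sigma>\<^sup>2) (at z)"
        using assms(1) by (auto intro!: derivative_eq_intros simp: power2_eq_square)
      from DERIV_cmult[OF DERIV_fun_exp[OF this], of "- (\<sigma>\<^sup>2 / s * K)"] show ?thesis
        unfolding nd using assms(1) by (simp add: mult_ac)
    qed
    show "((\<lambda>z. - (\<sigma>\<^sup>2 / s * normal_density 0 \<sigma> z)) \<longlongrightarrow> 0) at_top"
      unfolding nd using assms K by real_asymp
    show "0 \<le> z / s * normal_density 0 \<sigma> z" if "s \<le> z" for z
      using that assms by simp
  qed simp
  finally show ?thesis by simp
qed

lemma normal_two_sided_tail:
  assumes \<sigma>: "\<sigma> > 0" and u: "u > 0"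
  shows "(\<integral>\<^sup>+z. indicator {z. u\<^sup>2 < z\<^sup>2 / \<sigma>\<^sup>2} z * ennreal (normal_density 0 \<sigma> z) \<partial>lborel)
    \<le> ennreal (2 * exp (- u\<^sup>2 / 2) / (u * sqrt (2 * pi)))"
proof -
  let ?s = "u * \<sigma>" and ?f = "normal_density 0 \<sigma>"
  have "(\<integral>\<^sup>+z. indicator {z. u\<^sup>2 < z\<^sup>2 / \<sigma>\<^sup>2} z * ennreal (?f z) \<partial>lborel)
      \<le> (\<integral>\<^sup>+z. ennreal (?f z) * indicator {?s..} z + ennreal (?f z) * indicator {?s..} (- z) \<partial>lborel)"
  proof (intro nn_integral_mono)
    fix z :: real
    have "?s \<le> z \<or> ?s \<le> - z" if "u\<^sup>2 < z\<^sup>2 / \<sigma>\<^sup>2"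
    proof -
      have "?s\<^sup>2 < \<bar>z\<bar>\<^sup>2" using that \<sigma> by (simp add: power_mult_distrib field_simps)
      then have "?s < \<bar>z\<bar>" by (rule power_less_imp_less_base) simp
      then show ?thesis by linarith
    qed
    then show "indicator {z. u\<^sup>2 < z\<^sup>2 / \<sigma>\<^sup>2} z * ennreal (?f z)
        \<le> ennreal (?f z) * indicator {?s..} z + ennreal (?f z) * indicator {?s..} (- z)"
      by (auto simp: indicator_def)
  qed
  also have "\<dots> = (\<integral>\<^sup>+z. ennreal (?f z) * indicator {?s..} z \<partial>lborel) + (\<integral>\<^sup>+z. ennreal (?f z) * indicator {?s..} (- z) \<partial>lborel)"
    by (rule nn_integral_add) auto
  also have "(\<integral>\<^sup>+z. ennreal (?f z) * indicator {?s..} (- z) \<partial>lborel) = (\<integral>\<^sup>+z. ennreal (?f z) * indicator {?s..} z \<partial>lborel)"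
    by (subst nn_integral_real_affine[where c = "-1" and t = 0]) (simp_all add: normal_density_def)
  also have "(\<integral>\<^sup>+z. ennreal (?f z) * indicator {?s..} z \<partial>lborel) + (\<integral>\<^sup>+z. ennreal (?f z) * indicator {?s..} z \<partial>lborel)
      \<le> ennreal (\<sigma>\<^sup>2 / ?s * ?f ?s) + ennreal (\<sigma>\<^sup>2 / ?s * ?f ?s)"
    using normal_upper_tail[OF \<sigma>, of ?s] \<sigma> u by (intro add_mono) auto
  also have "\<dots> = ennreal (2 * (\<sigma>\<^sup>2 / ?s * ?f ?s))"
    using \<sigma> u by (subst ennreal_plus[symmetric]) auto
  also have "2 * (\<sigma>\<^sup>2 / ?s * ?f ?s) = 2 * exp (- u\<^sup>2 / 2) / (u * sqrt (2 * pi))"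
    using \<sigma> u by (simp add: normal_density_def real_sqrt_mult power_mult_distrib power2_eq_square)
  finally show ?thesis .
qed

text \<open>Under the null model the residual is normal with variance \<open>cond_var \<rho> (card I - 1)\<close>; this
  bounds each term of the union bound.\<close>

lemma equicor_residual_tail:
  fixes i :: 'a
  assumes rho: "0 \<le> \<rho>" "\<rho> < 1" and I: "finite I" "i \<in> I" and u: "u > 0"
  shows "emeasure (density (\<Pi>\<^sub>M i\<in>I. lborel) (\<lambda>x. ennreal (equicor_density \<rho> I x)))
      {x \<in> space (\<Pi>\<^sub>M i\<in>I. lborel).
         u\<^sup>2 < (x i - cond_mean \<rho> (I - {i}) x)\<^sup>2 / cond_var \<rho> (card I - 1)}
    \<le> ennreal (2 * exp (- u\<^sup>2 / 2) / (u * sqrt (2 * pi)))"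
proof -
  let ?J = "I - {i}" and ?L = "\<Pi>\<^sub>M i\<in>I. (lborel :: real measure)"
  have J: "finite ?J" "i \<notin> ?J" "insert i ?J = I" "card ?J = card I - 1" using I by auto
  let ?s = "cond_var \<rho> (card ?J)"
  have s: "?s > 0" by (rule cond_var_lower_bound[OF rho])
  have [measurable]: "(\<lambda>x. cond_mean \<rho> ?J x) \<in> borel_measurable ?L"
    unfolding cond_mean_def by measurable
  have [measurable]: "(\<lambda>x. x i) \<in> borel_measurable ?L" using I by measurable
  have g: "(indicator {z. u\<^sup>2 < z\<^sup>2 / ?s} :: real \<Rightarrow> ennreal) \<in> borel_measurable borel"
    by measurable
  let ?A = "{x \<in> space ?L. u\<^sup>2 < (x i - cond_mean \<rho> ?J x)\<^sup>2 / ?s}"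
  have "emeasure (density ?L (\<lambda>x. ennreal (equicor_density \<rho> I x))) ?A
      = (\<integral>\<^sup>+x. ennreal (equicor_density \<rho> I x) * indicator ?A x \<partial>?L)"
    by (rule emeasure_density) measurable
  also have "\<dots> = (\<integral>\<^sup>+x. indicator {z. u\<^sup>2 < z\<^sup>2 / ?s} (x i - cond_mean \<rho> ?J x)
       * ennreal (equicor_density \<rho> I x) \<partial>?L)"
    by (intro nn_integral_cong) (auto simp: indicator_def)
  also have "\<dots> = (\<integral>\<^sup>+z. indicator {z. u\<^sup>2 < z\<^sup>2 / ?s} z * ennreal (normal_density 0 (sqrt ?s) z) \<partial>lborel)"
    using nn_integral_equicor_residual[OF rho J(1,2) g]
    unfolding J(3) nn_integral_equicor_density[OF rho J(1)] by (simp only: mult_1_right)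
  also have "\<dots> \<le> ennreal (2 * exp (- u\<^sup>2 / 2) / (u * sqrt (2 * pi)))"
    using normal_two_sided_tail[of "sqrt ?s" u] s u by simp
  finally show ?thesis by (simp add: J(4))
qed

section \<open>The models in closed form\<close>

text \<open>By Cramer's rule, the corner entry of the inverse is the determinant of the matrix with one
  row and column removed, which is again an equicorrelation matrix, divided by the full
  determinant. That entry is \<open>1 / cond_var \<rho> n\<close>, so the determinants satisfy the recursion of
  \<open>equicor_det\<close>.\<close>

lemma det_equicorrelation:
  assumes rho: "0 \<le> \<rho>" "\<rho> < 1"
  shows "Determinant.det (equicorrelation n \<rho>) = equicor_det \<rho> n"
proof (induction n)
  case 0
  then show ?case
    using rho by (simp add: equicorrelation_def equicor_det_def top_eigenvalue_def det_dim_zero)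
next
  case (Suc n)
  let ?S = "equicorrelation (Suc n) \<rho>"
  define B where "B = the (mat_inverse ?S)"
  have B: "mat_inverse ?S = Some B" by (simp add: B_def equicorrelation_inverse[OF rho])
  have S: "?S \<in> carrier_mat (Suc n) (Suc n)" by (simp add: equicorrelation_def)
  have inv: "?S * B = 1\<^sub>m (Suc n)" "B * ?S = 1\<^sub>m (Suc n)" "B \<in> carrier_mat (Suc n) (Suc n)"
    using mat_inverse(2)[OF S B] by auto
  note adj = adj_mat[OF S]
  have "B $$ (0, 0) * cond_var \<rho> n = 1"
  proof -
    have "B $$ (0, 0) = 1 / (1 - \<rho>) - \<rho> / ((1 - \<rho>) * top_eigenvalue \<rho> (Suc n))"
      by (simp add: B_def equicorrelation_inverse[OF rho] top_eigenvalue_def)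
    then show ?thesis
      using cond_var_lower_bound(2)[OF rho, of n] by (simp add: inverse_cond_var[OF rho])
  qed
  moreover have "Determinant.det (equicorrelation n \<rho>) = Determinant.det ?S * B $$ (0, 0)"
  proof -
    have "adj_mat ?S = adj_mat ?S * (?S * B)" using inv adj by simp
    also have "\<dots> = (adj_mat ?S * ?S) * B"
      using adj(1) S inv(3) by (rule assoc_mult_mat[symmetric])
    also have "\<dots> = (Determinant.det ?S \<cdot>\<^sub>m 1\<^sub>m (Suc n)) * B"
      by (simp only: adj(3))
    also have "\<dots> = Determinant.det ?S \<cdot>\<^sub>m B"
      using inv by (simp add: mult_smult_assoc_mat[of _ "Suc n" "Suc n" _ "Suc n"])
    finally have "adj_mat ?S $$ (0, 0) = Determinant.det ?S * B $$ (0, 0)"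
      using inv by auto
    moreover have "mat_delete ?S 0 0 = equicorrelation n \<rho>"
      by (rule eq_matI) (auto simp: mat_delete_def equicorrelation_def)
    ultimately show ?thesis using S by (simp add: adj_mat_def cofactor_def)
  qed
  ultimately show ?case by (simp add: Suc.IH equicor_det_Suc[OF rho])
qed

lemma mvn_density_equicorrelation:
  assumes rho: "0 \<le> \<rho>" "\<rho> < 1"
  shows "mvn_density n (0\<^sub>v n) (equicorrelation n \<rho>) x = equicor_density \<rho> {1..n} x"
proof -
  define c where "c = \<rho> / ((1 - \<rho>) * (1 + (real n - 1) * \<rho>))"
  have sum1: "(\<Sum>i\<in>{1..n}. h i) = (\<Sum>j<n. h (Suc j))" for h :: "nat \<Rightarrow> real"
    by (simp add: sum.atLeast1_atMost_eq)
  have "(\<Sum>j<n. \<Sum>k<n. ((if j = k then 1 / (1 - \<rho>) else 0) - c) * x (Suc j) * x (Suc k))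
      = (\<Sum>j<n. \<Sum>k<n. (if j = k then (x (Suc j))\<^sup>2 / (1 - \<rho>) else 0) - c * (x (Suc j) * x (Suc k)))"
    by (intro sum.cong refl) (simp add: power2_eq_square algebra_simps)
  also have "\<dots> = (\<Sum>j<n. (x (Suc j))\<^sup>2) / (1 - \<rho>) - c * (\<Sum>j<n. \<Sum>k<n. x (Suc j) * x (Suc k))"
    by (simp add: sum_subtractf sum_distrib_left sum_divide_distrib)
  also have "(\<Sum>j<n. \<Sum>k<n. x (Suc j) * x (Suc k)) = (\<Sum>j<n. x (Suc j))\<^sup>2"
    by (simp add: power2_eq_square sum_product)
  finally show ?thesis
    unfolding equicor_density_def sum1
    by (subst mvn_density_altdef[OF equicorrelation_inverse[OF rho]])
       (simp_all add: det_equicorrelation[OF rho] top_eigenvalue_def c_def)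
qed

text \<open>The covariance under model \<open>i\<close> is a rank-one update of the null covariance, so the
  quadratic forms of the two densities differ by a multiple of the square of the \<open>i\<close>-th
  coordinate of \<open>\<Sigma>\<^sub>0\<^sup>-\<^sup>1 x\<close>; that coordinate is the residual \<open>z\<close> divided by its variance.\<close>

lemma marginal_density_ratio:
  fixes x :: "nat \<Rightarrow> real"
  assumes rho: "0 \<le> \<rho>" "\<rho> < 1" and tau: "\<tau>\<^sup>2 > 0" and i: "i \<in> {1..n}"
  defines "s \<equiv> cond_var \<rho> (n - 1)" and "z \<equiv> x i - cond_mean \<rho> ({1..n} - {i}) x"
  shows "marginal_density n \<rho> \<tau> i x =
    exp (\<tau>\<^sup>2 * z\<^sup>2 / (2 * s * (s + \<tau>\<^sup>2))) * sqrt (s / (s + \<tau>\<^sup>2)) * marginal_density n \<rho> \<tau> 0 x"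
proof -
  let ?S = "equicorrelation n \<rho>" and ?T = "marginal_covariance n \<rho> \<tau> i" and ?i = "i - 1"
  define B where "B = the (mat_inverse ?S)"
  define b where "b = B $$ (?i, ?i)"
  define \<kappa> where "\<kappa> = \<tau>\<^sup>2 / (1 + \<tau>\<^sup>2 * b)"
  note * = marginal_covariance_inverse_det[OF rho i, folded B_def, folded b_def]
  note b = *(1) and B = *(2) and sym = *(3) and inv = *(4)[of \<tau>, folded \<kappa>_def] and det = *(5)[of \<tau>]
  have i': "?i < n" "Suc ?i = i" and n: "real (n - 1) = real n - 1" using i by auto
  have invS: "mat_inverse ?S = Some B" by (simp add: B_def equicorrelation_inverse[OF rho])
  define q where "q = (\<Sum>j<n. \<Sum>k<n. B $$ (j, k) * x (Suc j) * x (Suc k))"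
  define a where "a = (\<Sum>k<n. B $$ (?i, k) * x (Suc k))"
  have a': "a = (\<Sum>j<n. B $$ (j, ?i) * x (Suc j))"
    unfolding a_def using sym[OF _ i'(1)] by (intro sum.cong refl) (metis lessThan_iff)
  have s: "s > 0" unfolding s_def by (rule cond_var_lower_bound[OF rho])
  define e where "e = top_eigenvalue \<rho> (n - 1)"
  have e: "e > 0" "e + \<rho> > 0" "1 - \<rho> > 0"
    using top_eigenvalue_pos[OF rho] rho by (auto simp: e_def add_pos_nonneg)
  \<comment> \<open>The top eigenvalue for all \<open>n\<close> coordinates, as it appears in the inverse matrix; \<open>e\<close> is
    the one for the \<open>n - 1\<close> remaining coordinates.\<close>
  have en: "1 + (real n - 1) * \<rho> = e + \<rho>"
    unfolding e_def top_eigenvalue_def n by (simp add: algebra_simps)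
  have se: "s = (1 - \<rho>) * (e + \<rho>) / e"
    by (simp add: s_def cond_var_def e_def top_eigenvalue_Suc)
  have Bentry: "B $$ (j, k) = (if j = k then 1 / (1 - \<rho>) else 0) - \<rho> / ((1 - \<rho>) * (e + \<rho>))"
    if "j < n" "k < n" for j k
    using that by (simp add: B_def equicorrelation_inverse[OF rho] en)
  have bs: "b = 1 / s"
    using Bentry[OF i'(1) i'(1)] inverse_cond_var[OF rho, of "n - 1"]
    by (simp only: b_def s_def e_def top_eigenvalue_Suc if_True simp_thms)
  have az: "a = z / s"
  proof -
    have "a = (\<Sum>k<n. (if k = ?i then x (Suc k) / (1 - \<rho>) else 0)
                - \<rho> / ((1 - \<rho>) * (e + \<rho>)) * x (Suc k))"
      unfolding a_def using i' by (intro sum.cong refl) (auto simp: Bentry algebra_simps)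
    also have "\<dots> = x i / (1 - \<rho>) - \<rho> / ((1 - \<rho>) * (e + \<rho>)) * (\<Sum>k<n. x (Suc k))"
      using i' by (simp add: sum_subtractf sum_distrib_left)
    also have "(\<Sum>k<n. x (Suc k)) = sum x {1..n}" by (simp add: sum.atLeast1_atMost_eq)
    also have "\<dots> = x i + sum x ({1..n} - {i})" using i by (simp add: sum.remove)
    finally have "a = x i / (1 - \<rho>)
        - \<rho> / ((1 - \<rho>) * (e + \<rho>)) * (x i + sum x ({1..n} - {i}))" .
    moreover have "z = x i - \<rho> * sum x ({1..n} - {i}) / e"
      using i by (simp add: z_def cond_mean_def e_def)
    ultimately show ?thesis
      using e by (simp add: se divide_simps) (simp add: algebra_simps)
  qed
  have marg: "mvn_density n (0\<^sub>v n) ?T x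
      = exp (- (q - \<kappa> * a\<^sup>2) / 2) / sqrt ((2 * pi) ^ n * Determinant.det ?T)"
  proof -
    have "(\<Sum>j<n. \<Sum>k<n. (B $$ (j, k) - \<kappa> * B $$ (j, ?i) * B $$ (?i, k)) * x (Suc j) * x (Suc k))
       = q - \<kappa> * ((\<Sum>j<n. B $$ (j, ?i) * x (Suc j)) * (\<Sum>k<n. B $$ (?i, k) * x (Suc k)))"
      unfolding q_def sum_product unfolding sum_distrib_left sum_subtractf[symmetric]
      by (intro sum.cong refl) (simp add: algebra_simps)
    also have "\<dots> = q - \<kappa> * a\<^sup>2" by (simp only: a'[symmetric] a_def[symmetric] power2_eq_square)
    finally show ?thesis by (subst mvn_density_altdef[OF inv]) simp_all
  qed
  have null: "mvn_density n (0\<^sub>v n) ?S x = exp (- q / 2) / sqrt ((2 * pi) ^ n * Determinant.det ?S)"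
    by (subst mvn_density_altdef[OF invS B]) (simp_all add: q_def)
  have k: "\<kappa> * a\<^sup>2 / 2 = \<tau>\<^sup>2 * z\<^sup>2 / (2 * s * (s + \<tau>\<^sup>2))"
    using s tau by (simp add: \<kappa>_def az bs field_simps power2_eq_square)
  have d: "1 / sqrt (1 + \<tau>\<^sup>2 * b) = sqrt (s / (s + \<tau>\<^sup>2))"
  proof -
    have "1 + \<tau>\<^sup>2 * b = (s + \<tau>\<^sup>2) / s" using s by (simp add: bs add_divide_distrib)
    then show ?thesis by (simp add: real_sqrt_divide)
  qed
  define D where "D = sqrt ((2 * pi) ^ n * Determinant.det ?S)"
  have D: "sqrt ((2 * pi) ^ n * Determinant.det ?T) = D * sqrt (1 + \<tau>\<^sup>2 * b)"
    by (simp add: D_def det real_sqrt_mult)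
  have "- (q - \<kappa> * a\<^sup>2) / 2 = \<kappa> * a\<^sup>2 / 2 + - q / 2"
    by (simp add: diff_divide_distrib)
  then have ex: "exp (- (q - \<kappa> * a\<^sup>2) / 2) = exp (\<kappa> * a\<^sup>2 / 2) * exp (- q / 2)"
    by (simp only: exp_add)
  have null': "marginal_density n \<rho> \<tau> 0 x = exp (- q / 2) / D"
    by (simp only: marginal_density_def null D_def if_True simp_thms)
  have "marginal_density n \<rho> \<tau> i x
      = exp (\<kappa> * a\<^sup>2 / 2) * (1 / sqrt (1 + \<tau>\<^sup>2 * b)) * marginal_density n \<rho> \<tau> 0 x"
    unfolding marginal_density_eq[OF rho i tau] marg null' D ex 
    by (simp add: mult_ac)
  then show ?thesis by (simp only: k d)
qed

section \<open>From the posterior threshold to the tail\<close>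

text \<open>The denominator of the posterior is at least its null term \<open>r m\<^sub>0\<close>, and the factor
  \<open>sqrt (s / (s + \<tau>\<^sup>2))\<close> of the likelihood ratio is at most \<open>1\<close>. Only the bound
  \<open>s \<ge> 1 - \<rho>\<close> on the conditional variance enters, so the resulting threshold depends on
  \<open>n\<close> through the logarithm alone. The hypothesis \<open>large\<close> makes that logarithm
  nonnegative, as replacing \<open>s\<close> by \<open>1 - \<rho>\<close> in its coefficient requires.\<close>

lemma posterior_threshold_imp_large_residual:
  assumes r: "0 < r" "r < 1" and rho: "0 \<le> \<rho>" "\<rho> < 1" and tau: "\<tau>\<^sup>2 > 0" and p: "0 < p"
    and i: "i \<in> {1..n}" and large: "p * r / (1 - r) * real n \<ge> 1"
    and post: "posterior_prob n r \<rho> \<tau> i x > p"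
  shows "2 * (1 + (1 - \<rho>) / \<tau>\<^sup>2) * ln (p * r / (1 - r) * real n)
    < (x i - cond_mean \<rho> ({1..n} - {i}) x)\<^sup>2 / cond_var \<rho> (n - 1)"
proof -
  define s where "s = cond_var \<rho> (n - 1)"
  define z where "z = x i - cond_mean \<rho> ({1..n} - {i}) x"
  define E where "E = \<tau>\<^sup>2 * z\<^sup>2 / (2 * s * (s + \<tau>\<^sup>2))"
  define m where "m j = marginal_density n \<rho> \<tau> j x" for j
  have s: "s > 0" "1 - \<rho> \<le> s" unfolding s_def by (rule cond_var_lower_bound[OF rho])+
  have n: "real n > 0" using i by auto
  have m0: "m 0 > 0"
    using top_eigenvalue_pos[OF rho, of n] rho
    by (simp add: m_def marginal_density_def mvn_density_equicorrelation[OF rho]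
        equicor_density_def equicor_det_def)
  \<comment> \<open>The ratio is used for every model: it also shows that all summands of the denominator are
    nonnegative.\<close>
  have ratio: "m j = exp (\<tau>\<^sup>2 * (x j - cond_mean \<rho> ({1..n} - {j}) x)\<^sup>2 / (2 * s * (s + \<tau>\<^sup>2)))
      * sqrt (s / (s + \<tau>\<^sup>2)) * m 0" if "j \<in> {1..n}" for j
    using marginal_density_ratio[OF rho tau that, of x] by (simp only: m_def s_def)
  have mnn: "m j \<ge> 0" if "j \<in> {1..n}" for j
    using ratio[OF that] m0 s tau by simp
  have "s + \<tau>\<^sup>2 > 0" using s(1) tau by linarith
  then have "sqrt (s / (s + \<tau>\<^sup>2)) \<le> 1" by simp
  then have "exp E * sqrt (s / (s + \<tau>\<^sup>2)) * m 0 \<le> exp E * 1 * m 0"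
    using m0 by (intro mult_right_mono mult_left_mono) auto
  then have mi: "m i \<le> exp E * m 0" using ratio[OF i] by (simp add: E_def z_def)
  let ?Z = "\<Sum>j=0..n. m j * prior_prob n r j"
  have Z: "m 0 * r \<le> ?Z"
  proof -
    have "?Z = m 0 * r + (\<Sum>j=1..n. m j * prior_prob n r j)"
      by (simp add: sum.atLeast_Suc_atMost prior_prob_def)
    moreover have "(\<Sum>j=1..n. m j * prior_prob n r j) \<ge> 0"
      using mnn r by (intro sum_nonneg mult_nonneg_nonneg) (auto simp: prior_prob_def)
    ultimately show ?thesis by simp
  qed
  have Zpos: "?Z > 0" using Z m0 r by (meson less_le_trans mult_pos_pos)
  have "p < m i * prior_prob n r i / ?Z"
    using post by (simp only: posterior_prob_def m_def)
  then have "p * ?Z < m i * prior_prob n r i"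
    by (simp only: pos_less_divide_eq[OF Zpos])
  moreover have "prior_prob n r i = (1 - r) / real n"
    using i by (simp add: prior_prob_def)
  moreover have "p * (m 0 * r) \<le> p * ?Z" using Z p by (intro mult_left_mono) auto
  moreover have "m i * ((1 - r) / real n) \<le> exp E * m 0 * ((1 - r) / real n)"
    using mi r by (intro mult_right_mono) auto
  ultimately have "p * (m 0 * r) < exp E * m 0 * ((1 - r) / real n)" by simp
  then have "m 0 * (p * r / (1 - r) * real n) < m 0 * exp E"
    using n r by (simp add: field_simps)
  then have "p * r / (1 - r) * real n < exp E"
    by (simp only: mult_less_cancel_left_pos[OF m0])
  moreover have "p * r / (1 - r) * real n > 0" using large by linarith
  ultimately have "ln (p * r / (1 - r) * real n) < ln (exp E)"
    by (simp only: ln_less_cancel_iff exp_gt_zero)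
  then have lnE: "ln (p * r / (1 - r) * real n) < E"
    by (simp only: ln_exp)
  have "2 * (1 + (1 - \<rho>) / \<tau>\<^sup>2) * ln (p * r / (1 - r) * real n)
      \<le> 2 * (1 + s / \<tau>\<^sup>2) * ln (p * r / (1 - r) * real n)"
    using s tau large by (intro mult_right_mono mult_left_mono add_left_mono divide_right_mono) auto
  also have "\<dots> < 2 * (1 + s / \<tau>\<^sup>2) * E"
    using lnE s tau by (intro mult_strict_left_mono) (auto intro: add_pos_pos)
  also have "\<dots> = z\<^sup>2 / s"
  proof -
    have "2 * (1 + s / t) * (t * z\<^sup>2 / (2 * s * (s + t))) = z\<^sup>2 / s" if "t > 0" for t
      using s(1) that by (simp add: divide_simps) algebra
    from this[OF tau] show ?thesis by (simp only: E_def)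
  qed
  finally show ?thesis by (simp only: z_def s_def)
qed

text \<open>The union bound, valid for each sample size with \<open>C n > 1\<close> (so that \<open>u > 0\<close>), where
  \<open>C = p r / (1 - r)\<close>.\<close>

lemma false_positive_prob_le:
  assumes r: "0 < r" "r < 1" and rho: "0 \<le> \<rho>" "\<rho> < 1" and tau: "\<tau>\<^sup>2 > 0" and p: "0 < p"
    and large: "p * r / (1 - r) * real n > 1"
  defines "u \<equiv> sqrt (2 * (1 + (1 - \<rho>) / \<tau>\<^sup>2) * ln (p * r / (1 - r) * real n))"
  shows "false_positive_prob n r \<rho> \<tau> p \<le> real n * (2 * exp (- u\<^sup>2 / 2) / (u * sqrt (2 * pi)))"
proof -
  let ?L = "\<Pi>\<^sub>M i\<in>{1..n}. (lborel :: real measure)"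
  define M where "M = mvn n (0\<^sub>v n) (equicorrelation n \<rho>)"
  define A where "A = (\<lambda>i. {x \<in> space ?L.
    u\<^sup>2 < (x i - cond_mean \<rho> ({1..n} - {i}) x)\<^sup>2 / cond_var \<rho> (n - 1)})"
  define T where "T = 2 * exp (- u\<^sup>2 / 2) / (u * sqrt (2 * pi))"
  have M: "M = density ?L (\<lambda>x. ennreal (equicor_density \<rho> {1..n} x))"
    by (simp add: M_def mvn_def mvn_density_equicorrelation[OF rho])
  have "2 * (1 + (1 - \<rho>) / \<tau>\<^sup>2) * ln (p * r / (1 - r) * real n) > 0"
    using large rho tau by (intro mult_pos_pos) (auto intro!: add_pos_nonneg)
  then have u: "u > 0" and u2: "u\<^sup>2 = 2 * (1 + (1 - \<rho>) / \<tau>\<^sup>2) * ln (p * r / (1 - r) * real n)"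
    by (auto simp: u_def)
  have T: "T \<ge> 0" using u by (simp add: T_def)
  have A_sets: "A i \<in> sets M" if "i \<in> {1..n}" for i
  proof -
    have [measurable]: "(\<lambda>x. cond_mean \<rho> ({1..n} - {i}) x) \<in> borel_measurable ?L"
      unfolding cond_mean_def by measurable
    have [measurable]: "(\<lambda>x. x i) \<in> borel_measurable ?L" using that by measurable
    have "A i \<in> sets ?L" unfolding A_def by measurable
    then show ?thesis by (simp add: M)
  qed
  let ?F = "{x \<in> space M. \<exists>i\<in>{1..n}. posterior_prob n r \<rho> \<tau> i x > p}"
  have "?F \<subseteq> (\<Union>i\<in>{1..n}. A i)"
    using posterior_threshold_imp_large_residual[OF r rho tau p _ less_imp_le[OF large]]
    by (fastforce simp: A_def u2 M)
  then have "emeasure M ?F \<le> emeasure M (\<Union>i\<in>{1..n}. A i)"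
    using A_sets by (intro emeasure_mono) auto
  also have "\<dots> \<le> (\<Sum>i\<in>{1..n}. emeasure M (A i))"
    using A_sets by (intro emeasure_subadditive_finite) auto
  also have "\<dots> \<le> (\<Sum>i\<in>{1..n}. ennreal T)"
    using equicor_residual_tail[OF rho _ _ u, of "{1..n}"]
    by (intro sum_mono) (simp add: M A_def T_def)
  also have "\<dots> = ennreal (real n * T)"
    using T by (subst sum_ennreal) auto
  finally have "emeasure M ?F \<le> ennreal (real n * T)" .
  then have "measure M ?F \<le> real n * T"
    unfolding measure_def using T by (intro enn2real_leI mult_nonneg_nonneg) auto
  then show ?thesis by (simp only: false_positive_prob_def M_def Let_def T_def)
qed

text \<open>With \<open>exp (- u\<^sup>2 / 2) = (C n)\<^sup>-\<^sup>1\<^sup>-\<^sup>\<alpha>\<close> and \<open>u\<close> of order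
  \<open>sqrt (ln n)\<close>, the explicit bound has the asserted order; \<open>C\<close> contributes only a constant
  factor.\<close>

theorem theorem5p9:
  fixes r \<rho> \<tau> p :: real
  assumes "0 < r" "r < 1"
    and "0 \<le> \<rho>" "\<rho> < 1"
    and "\<tau>\<^sup>2 > 0"
    and "0 < p" "p < 1"
  shows "(\<lambda>n. false_positive_prob n r \<rho> \<tau> p)
    \<in> O(\<lambda>n. real n powr (- ((1 - \<rho>) / \<tau>\<^sup>2)) * ln (real n) powr (- 1 / 2))"
proof -
  define \<alpha> where "\<alpha> = (1 - \<rho>) / \<tau>\<^sup>2"
  define C where "C = p * r / (1 - r)"
  have \<alpha>: "\<alpha> > 0" and C: "C > 0" using assms by (auto simp: \<alpha>_def C_def)
  define u where "u = (\<lambda>n. sqrt (2 * (1 + \<alpha>) * ln (C * real n)))"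
  have large: "eventually (\<lambda>n. C * real n > 1) at_top"
    using C by real_asymp
  have "(\<lambda>n. false_positive_prob n r \<rho> \<tau> p)
      \<in> O(\<lambda>n. real n * (2 * exp (- (u n)\<^sup>2 / 2) / (u n * sqrt (2 * pi))))"
  proof (rule bigoI[where c = 1])
    show "eventually (\<lambda>n. norm (false_positive_prob n r \<rho> \<tau> p)
      \<le> 1 * norm (real n * (2 * exp (- (u n)\<^sup>2 / 2) / (u n * sqrt (2 * pi))))) at_top"
      using large
    proof eventually_elim
      case (elim n)
      have "false_positive_prob n r \<rho> \<tau> p \<le> real n * (2 * exp (- (u n)\<^sup>2 / 2) / (u n * sqrt (2 * pi)))"
        using false_positive_prob_le[of r \<rho> \<tau> p n] assms elim by (simp add: u_def \<alpha>_def C_def)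
      moreover have "false_positive_prob n r \<rho> \<tau> p \<ge> 0"
        by (simp add: false_positive_prob_def Let_def)
      ultimately show ?case by (smt (verit) mult_1 real_norm_def)
    qed
  qed
  also have "(\<lambda>n. real n * (2 * exp (- (u n)\<^sup>2 / 2) / (u n * sqrt (2 * pi))))
      \<in> O(\<lambda>n. real n * (2 * exp (- (1 + \<alpha>) * ln (C * real n))
                / (sqrt (2 * (1 + \<alpha>) * ln (C * real n)) * sqrt (2 * pi))))"
  proof (intro bigthetaD1 bigthetaI_cong)
    show "eventually (\<lambda>n. real n * (2 * exp (- (u n)\<^sup>2 / 2) / (u n * sqrt (2 * pi)))
      = real n * (2 * exp (- (1 + \<alpha>) * ln (C * real n))
                / (sqrt (2 * (1 + \<alpha>) * ln (C * real n)) * sqrt (2 * pi)))) at_top"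
      using large
    proof eventually_elim
      case (elim n)
      then have "- (u n)\<^sup>2 / 2 = - (1 + \<alpha>) * ln (C * real n)"
        using \<alpha> by (simp add: u_def) (simp add: field_simps)
      then show ?case by (simp only: u_def)
    qed
  qed
  also have "(\<lambda>n. real n * (2 * exp (- (1 + \<alpha>) * ln (C * real n))
                / (sqrt (2 * (1 + \<alpha>) * ln (C * real n)) * sqrt (2 * pi))))
      \<in> O(\<lambda>n. real n powr (- \<alpha>) * ln (real n) powr (- 1 / 2))"
    using \<alpha> C by real_asymp
  finally show ?thesis by (simp only: \<alpha>_def)
qed

end
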